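(* Let $I$ be an index set, $a^1,\dots,a^n,b\in\mathbb{R}^I$ and $c\in\mathbb{R}^n$, and suppose the semi-infinite linear program $$OV(b)=\inf\Big\{\sum_{k=1}^n c_kx_k : x\in\mathbb{R}^n,\ \sum_{k=1}^n a^k(i)x_k\ge b(i)\ \text{ for all } i\in I\Big\}$$ is feasible and bounded. Let $U=\mathrm{span}(a^1,\dots,a^n,b)\subseteq\mathbb{R}^I$. Then the dual problem $\mathrm{DSILP}(U)$ is solvable (its optimal value is attained) and strong duality (SD) holds for the pair consisting of the primal problem and $\mathrm{DSILP}(U)$. Moreover, $\mathrm{DSILP}(U)$ has a unique optimal dual solution.
   Context: Feasible and bounded means the feasible set is nonempty and $OV(b)>-\infty$. For a linear subspace $Y\subseteq\mathbb{R}^I$ containing $a^1,\dots,a^n,b$, let $Y'$ be its algebraic dual (all real linear functionals on $Y$) and $Y'_+=\{\psi\in Y' : \psi(y)\ge 0 \text{ for all } y\in Y\cap\mathbb{R}^I_+\}$, where $\mathbb{R}^I_+$ is the set of nonnegative functions on $I$. The dual problem $\mathrm{DSILP}(Y)$ is: maximize $\psi(b)$ over $\psi\in Y'_+$ with $\psi(a^k)=c_k$ for $k=1,\dots,n$. Property (SD) holds for the pair (primal, $\mathrm{DSILP}(Y)$) if there exists $\psi^*\in Y'_+$ with $\psi^*(a^k)=c_k$ for $k=1,\dots,n$ and $\psi^*(b)=OV(b)$. *)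

theory Defs
  imports "HOL-Analysis.Analysis" "HOL-Library.Function_Algebras"
begin

text \<open>
  Functions form a real vector space under the pointwise operations (addition is the one of
  \<open>Function_Algebras\<close>), so that the library's \<open>span\<close> and \<open>subspace\<close> apply to them.
\<close>

instantiation "fun" :: (type, real_vector) real_vector
begin

definition scaleR_fun :: "real \<Rightarrow> ('a \<Rightarrow> 'b) \<Rightarrow> 'a \<Rightarrow> 'b"
  where "scaleR_fun r f = (\<lambda>i. r *\<^sub>R f i)"

instance
  by standard (simp_all add: scaleR_fun_def plus_fun_def fun_eq_iff scaleR_add_right scaleR_add_left)

end

text \<open>
  The index set is an arbitrary, possibly empty, set \<open>I\<close> of elements of a type. The space of
  real functions on \<open>I\<close> is represented by the functions on the whole type that vanish off \<open>I\<close>;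
  this makes it a linear subspace of the function type.
\<close>

definition fun_space :: "'i set \<Rightarrow> ('i \<Rightarrow> real) set"
  where "fun_space I = {y. \<forall>i. i \<notin> I \<longrightarrow> y i = 0}"

definition nonneg_cone :: "'i set \<Rightarrow> ('i \<Rightarrow> real) set"
  where "nonneg_cone I = {y \<in> fun_space I. \<forall>i\<in>I. 0 \<le> y i}"

definition primal_feasible ::
    "'i set \<Rightarrow> ('n::finite \<Rightarrow> 'i \<Rightarrow> real) \<Rightarrow> ('i \<Rightarrow> real) \<Rightarrow> (real ^ 'n) set"
  where "primal_feasible I a b = {x. \<forall>i\<in>I. (\<Sum>k\<in>UNIV. a k i * x $ k) \<ge> b i}"

definition OV ::
    "'i set \<Rightarrow> ('n::finite \<Rightarrow> 'i \<Rightarrow> real) \<Rightarrow> real ^ 'n \<Rightarrow> ('i \<Rightarrow> real) \<Rightarrow> ereal"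
  where "OV I a c b = (INF x\<in>primal_feasible I a b. ereal (\<Sum>k\<in>UNIV. c $ k * x $ k))"

definition feasible_and_bounded ::
    "'i set \<Rightarrow> ('n::finite \<Rightarrow> 'i \<Rightarrow> real) \<Rightarrow> real ^ 'n \<Rightarrow> ('i \<Rightarrow> real) \<Rightarrow> bool"
  where "feasible_and_bounded I a c b \<longleftrightarrow> primal_feasible I a b \<noteq> {} \<and> OV I a c b > -\<infinity>"

text \<open>
  Functionals on a subspace \<open>Y\<close> are extensional (they take the value \<open>undefined\<close> off \<open>Y\<close>), so
  that two of them are equal in HOL exactly when they agree on \<open>Y\<close>.
\<close>

definition algebraic_dual :: "'v::real_vector set \<Rightarrow> ('v \<Rightarrow> real) set"
  where "algebraic_dual Y = {\<psi> \<in> extensional Y.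
    (\<forall>y\<in>Y. \<forall>z\<in>Y. \<psi> (y + z) = \<psi> y + \<psi> z) \<and>
    (\<forall>r. \<forall>y\<in>Y. \<psi> (r *\<^sub>R y) = r * \<psi> y)}"

definition positive_dual :: "'i set \<Rightarrow> ('i \<Rightarrow> real) set \<Rightarrow> (('i \<Rightarrow> real) \<Rightarrow> real) set"
  where "positive_dual I Y = {\<psi> \<in> algebraic_dual Y. \<forall>y \<in> Y \<inter> nonneg_cone I. 0 \<le> \<psi> y}"

text \<open>
  In the dual notions below, \<open>Y\<close> is meant to be a linear subspace of \<open>fun_space I\<close> that
  contains \<open>b\<close> and every \<open>a k\<close>.
\<close>

definition dual_feasible ::
    "'i set \<Rightarrow> ('n::finite \<Rightarrow> 'i \<Rightarrow> real) \<Rightarrow> real ^ 'n \<Rightarrow> ('i \<Rightarrow> real) set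
      \<Rightarrow> (('i \<Rightarrow> real) \<Rightarrow> real) set"
  where "dual_feasible I a c Y = {\<psi> \<in> positive_dual I Y. \<forall>k. \<psi> (a k) = c $ k}"

definition dual_value ::
    "'i set \<Rightarrow> ('n::finite \<Rightarrow> 'i \<Rightarrow> real) \<Rightarrow> real ^ 'n \<Rightarrow> ('i \<Rightarrow> real) \<Rightarrow> ('i \<Rightarrow> real) set \<Rightarrow> ereal"
  where "dual_value I a c b Y = (SUP \<psi>\<in>dual_feasible I a c Y. ereal (\<psi> b))"

definition dual_optimal ::
    "'i set \<Rightarrow> ('n::finite \<Rightarrow> 'i \<Rightarrow> real) \<Rightarrow> real ^ 'n \<Rightarrow> ('i \<Rightarrow> real) \<Rightarrow> ('i \<Rightarrow> real) set
      \<Rightarrow> (('i \<Rightarrow> real) \<Rightarrow> real) \<Rightarrow> bool"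
  where "dual_optimal I a c b Y \<psi> \<longleftrightarrow>
    \<psi> \<in> dual_feasible I a c Y \<and> ereal (\<psi> b) = dual_value I a c b Y"

definition dual_solvable ::
    "'i set \<Rightarrow> ('n::finite \<Rightarrow> 'i \<Rightarrow> real) \<Rightarrow> real ^ 'n \<Rightarrow> ('i \<Rightarrow> real) \<Rightarrow> ('i \<Rightarrow> real) set \<Rightarrow> bool"
  where "dual_solvable I a c b Y \<longleftrightarrow> (\<exists>\<psi>. dual_optimal I a c b Y \<psi>)"

definition strong_duality ::
    "'i set \<Rightarrow> ('n::finite \<Rightarrow> 'i \<Rightarrow> real) \<Rightarrow> real ^ 'n \<Rightarrow> ('i \<Rightarrow> real) \<Rightarrow> ('i \<Rightarrow> real) set \<Rightarrow> bool"
  where "strong_duality I a c b Y \<longleftrightarrow>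
    (\<exists>\<psi>\<in>dual_feasible I a c Y. ereal (\<psi> b) = OV I a c b)"

definition data_span :: "('n::finite \<Rightarrow> 'i \<Rightarrow> real) \<Rightarrow> ('i \<Rightarrow> real) \<Rightarrow> ('i \<Rightarrow> real) set"
  where "data_span a b = span (insert b (range a))"

lemma subspace_fun_space: "subspace (fun_space I)"
  by (simp add: subspace_def fun_space_def scaleR_fun_def plus_fun_def zero_fun_def)

lemma data_span_admissible:
  fixes a :: "'n::finite \<Rightarrow> 'i \<Rightarrow> real"
  assumes "\<And>k. a k \<in> fun_space I" and "b \<in> fun_space I"
  shows "subspace (data_span a b)" "data_span a b \<subseteq> fun_space I"
    "b \<in> data_span a b" "a k \<in> data_span a b"
  using assms span_minimal[OF _ subspace_fun_space, of "insert b (range a)" I]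
  by (auto simp: data_span_def intro: span_base)

end

theory Submission
  imports Defs
begin

text \<open>
  Every element of \<open>U = span(a\<^sup>1, \<dots>, a\<^sup>n, b)\<close> has the form
  \<open>y = \<Sum>\<^sub>k x\<^sub>k a\<^sup>k + \<beta> b\<close>, so a linear functional on \<open>U\<close> with values \<open>c\<^sub>k\<close> at \<open>a\<^sup>k\<close> is
  determined by its value at \<open>b\<close>. Weak duality bounds that value by the primal value \<open>V\<close>, which
  is finite. The only candidate that closes the duality gap is therefore
  \<open>\<psi> y = c \<bullet> x + V \<beta>\<close>, and uniqueness is immediate; what remains is that this formula
  defines a positive functional.

  The core is the implication \<open>\<Sum>\<^sub>k x\<^sub>k a\<^sup>k + \<beta> b \<ge> 0 \<Longrightarrow> c \<bullet> x + V \<beta> \<ge> 0\<close>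
  (\<open>value_form_nonneg\<close>). It gives positivity directly. Applied to both signs of a representation
  of the zero function it also shows that the formula does not depend on the representation of \<open>y\<close>.
  The implication is elementary because \<open>b\<close> is the only generator of \<open>U\<close> besides the
  \<open>a\<^sup>k\<close>: the sign of \<open>\<beta>\<close> decides whether \<open>y \<ge> 0\<close> speaks of a feasible point or of a recession
  direction of the feasible set, and the objective is bounded below on the former and nonnegative
  on the latter.
\<close>

section \<open>Functionals on a subspace\<close>

lemma algebraic_dual_add:
  "\<psi> \<in> algebraic_dual Y \<Longrightarrow> y \<in> Y \<Longrightarrow> z \<in> Y \<Longrightarrow> \<psi> (y + z) = \<psi> y + \<psi> z"
  by (simp add: algebraic_dual_def)

lemma algebraic_dual_scaleR:
  "\<psi> \<in> algebraic_dual Y \<Longrightarrow> y \<in> Y \<Longrightarrow> \<psi> (r *\<^sub>R y) = r * \<psi> y"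
  by (simp add: algebraic_dual_def)

lemma algebraic_dual_sum:
  assumes \<psi>: "\<psi> \<in> algebraic_dual Y" and Y: "subspace Y"
    and "finite A" "\<And>k. k \<in> A \<Longrightarrow> f k \<in> Y"
  shows "\<psi> (sum f A) = (\<Sum>k\<in>A. \<psi> (f k))"
  using assms(3,4)
proof (induction A rule: finite_induct)
  case empty
  have "\<psi> (0 *\<^sub>R 0) = 0"
    using algebraic_dual_scaleR[OF \<psi> subspace_0[OF Y], of 0] by simp
  then show ?case by simp
next
  case (insert k A)
  then show ?case
    by (simp add: algebraic_dual_add[OF \<psi>] subspace_sum[OF Y])
qed

text \<open>
  A linear form on a parameter space descends to the image of a linear map as soon as it vanishes
  on the kernel; the choice of a preimage then does not matter.
\<close>

lemma functional_on_range_exists: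
  fixes L :: "'p::real_vector \<Rightarrow> 'v::real_vector" and F :: "'p \<Rightarrow> real"
  assumes L: "linear L" and F: "linear F" and ker: "\<And>p. L p = 0 \<Longrightarrow> F p = 0"
  obtains \<psi> where "\<psi> \<in> algebraic_dual (range L)" "\<And>p. \<psi> (L p) = F p"
proof -
  define \<psi> where "\<psi> = restrict (\<lambda>y. F (SOME p. L p = y)) (range L)"
  have val: "\<psi> (L p) = F p" for p
  proof -
    have "L (SOME q. L q = L p) = L p"
      by (rule someI) (rule refl)
    then have "F ((SOME q. L q = L p) - p) = 0"
      by (intro ker) (simp add: linear_diff[OF L])
    then show ?thesis
      by (simp add: \<psi>_def linear_diff[OF F])
  qed
  have "\<psi> (L p + L q) = \<psi> (L p) + \<psi> (L q)" for p q
    using val[of "p + q"] by (simp add: val linear_add[OF L] linear_add[OF F])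
  moreover have "\<psi> (r *\<^sub>R L p) = r * \<psi> (L p)" for r p
    using val[of "r *\<^sub>R p"] by (simp add: val linear_scale[OF L] linear_scale[OF F])
  moreover have "\<psi> \<in> extensional (range L)"
    by (simp add: \<psi>_def)
  ultimately have "\<psi> \<in> algebraic_dual (range L)"
    unfolding algebraic_dual_def by blast
  then show thesis using val that by blast
qed

section \<open>Parametrization of the span of the data\<close>

definition data_combination ::
    "('n::finite \<Rightarrow> 'i \<Rightarrow> real) \<Rightarrow> ('i \<Rightarrow> real) \<Rightarrow> (real ^ 'n) \<times> real \<Rightarrow> 'i \<Rightarrow> real"
  where "data_combination a b p = (\<Sum>k\<in>UNIV. fst p $ k *\<^sub>R a k) + snd p *\<^sub>R b"

lemma data_combination_apply:
  "data_combination a b p i = (\<Sum>k\<in>UNIV. a k i * fst p $ k) + b i * snd p"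
proof -
  have "(\<Sum>k\<in>A. f k) i = (\<Sum>k\<in>A. f k i)" if "finite A" for A and f :: "'a \<Rightarrow> 'b \<Rightarrow> real"
    using that by (induction A rule: finite_induct) auto
  then show ?thesis
    by (simp add: data_combination_def scaleR_fun_def mult.commute)
qed

lemma linear_data_combination: "linear (data_combination a b)"
  by (rule linearI)
    (auto simp: fun_eq_iff data_combination_apply scaleR_fun_def sum.distrib sum_distrib_left
      algebra_simps)

lemma data_combination_generators:
  "data_combination a b (axis k 1, 0) = a k" "data_combination a b (0, 1) = b"
  by (auto simp: fun_eq_iff data_combination_apply axis_def if_distrib cong: if_cong)

lemma data_span_eq_range: "data_span a b = range (data_combination a b)"
proof
  show "data_span a b \<subseteq> range (data_combination a b)"
    unfolding data_span_def
  proof (rule span_minimal)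
    show "insert b (range a) \<subseteq> range (data_combination a b)"
      by (metis data_combination_generators image_subset_iff insert_subset rangeI)
    show "subspace (range (data_combination a b))"
      by (rule linear_subspace_image[OF linear_data_combination subspace_UNIV])
  qed
  show "range (data_combination a b) \<subseteq> data_span a b"
    unfolding data_span_def data_combination_def
    by (auto intro!: span_add span_sum span_scale intro: span_base)
qed

lemma dual_feasible_data_combination:
  assumes "\<psi> \<in> dual_feasible I a c (data_span a b)"
  shows "\<psi> (data_combination a b (x, \<beta>)) = c \<bullet> x + \<beta> * \<psi> b"
proof -
  have \<psi>: "\<psi> \<in> algebraic_dual (data_span a b)" and c: "\<And>k. \<psi> (a k) = c $ k"
    using assms by (auto simp: dual_feasible_def positive_dual_def)
  have Y: "subspace (data_span a b)" and b: "b \<in> data_span a b" and a: "\<And>k. a k \<in> data_span a b"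
    by (auto simp: data_span_def intro: span_base)
  show ?thesis
    by (simp add: data_combination_def algebraic_dual_add[OF \<psi>] algebraic_dual_scaleR[OF \<psi>]
        algebraic_dual_sum[OF \<psi> Y] subspace_sum[OF Y] subspace_scale[OF Y] a b c
        inner_vec_def mult.commute)
qed

section \<open>Weak duality and uniqueness\<close>

lemma OV_eq_INF_inner: "OV I a c b = (INF x\<in>primal_feasible I a b. ereal (c \<bullet> x))"
  by (simp add: OV_def inner_vec_def)

lemma finite_primal_value:
  assumes "feasible_and_bounded I a c b"
  obtains V where "OV I a c b = ereal V" "\<And>x. x \<in> primal_feasible I a b \<Longrightarrow> V \<le> c \<bullet> x"
    "\<And>W. (\<And>x. x \<in> primal_feasible I a b \<Longrightarrow> W \<le> c \<bullet> x) \<Longrightarrow> W \<le> V"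
proof -
  obtain x where x: "x \<in> primal_feasible I a b"
    using assms by (auto simp: feasible_and_bounded_def)
  have "OV I a c b \<le> ereal (c \<bullet> x)"
    unfolding OV_eq_INF_inner by (rule INF_lower[OF x])
  moreover have "OV I a c b > -\<infinity>"
    using assms by (simp add: feasible_and_bounded_def)
  ultimately obtain V where V: "OV I a c b = ereal V"
    by (cases "OV I a c b") auto
  show thesis
  proof (rule that[OF V])
    show "V \<le> c \<bullet> x" if "x \<in> primal_feasible I a b" for x
      using INF_lower[OF that, of "\<lambda>x. ereal (c \<bullet> x)"] V by (simp add: OV_eq_INF_inner)
    show "W \<le> V" if "\<And>x. x \<in> primal_feasible I a b \<Longrightarrow> W \<le> c \<bullet> x" for W
      using INF_greatest[of "primal_feasible I a b" "ereal W" "\<lambda>x. ereal (c \<bullet> x)"] that V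
      by (simp add: OV_eq_INF_inner)
  qed
qed

text \<open>
  The slack \<open>\<Sum>\<^sub>k x\<^sub>k a\<^sup>k - b\<close> of a feasible \<open>x\<close> is a nonnegative element of the span, on
  which a dual feasible functional takes the value \<open>c \<bullet> x - \<psi> b\<close>.
\<close>

lemma weak_duality:
  assumes a: "\<And>k. a k \<in> fun_space I" and b: "b \<in> fun_space I"
    and \<psi>: "\<psi> \<in> dual_feasible I a c (data_span a b)"
  shows "ereal (\<psi> b) \<le> OV I a c b"
  unfolding OV_eq_INF_inner
proof (rule INF_greatest)
  fix x assume x: "x \<in> primal_feasible I a b"
  let ?s = "data_combination a b (x, -1)"
  have "?s \<in> data_span a b"
    by (simp add: data_span_eq_range)
  moreover have "?s \<in> nonneg_cone I"
    using x a b
    by (auto simp: nonneg_cone_def fun_space_def primal_feasible_def data_combination_apply)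
  ultimately have "0 \<le> \<psi> ?s"
    using \<psi> by (auto simp: dual_feasible_def positive_dual_def)
  then show "ereal (\<psi> b) \<le> ereal (c \<bullet> x)"
    by (simp add: dual_feasible_data_combination[OF \<psi>])
qed

lemma dual_feasible_determined_by_value:
  assumes \<psi>: "\<psi> \<in> dual_feasible I a c (data_span a b)"
    and \<phi>: "\<phi> \<in> dual_feasible I a c (data_span a b)" and eq: "\<psi> b = \<phi> b"
  shows "\<psi> = \<phi>"
proof (rule extensionalityI)
  show "\<psi> \<in> extensional (data_span a b)" "\<phi> \<in> extensional (data_span a b)"
    using \<psi> \<phi> by (auto simp: dual_feasible_def positive_dual_def algebraic_dual_def)
  show "\<psi> y = \<phi> y" if "y \<in> data_span a b" for y
    using that eq dual_feasible_data_combination[OF \<psi>] dual_feasible_data_combination[OF \<phi>]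
    by (auto simp: data_span_eq_range)
qed

section \<open>The functional given by the primal value\<close>

text \<open>
  According to the sign of \<open>\<beta>\<close>, nonnegativity of \<open>\<Sum>\<^sub>k x\<^sub>k a\<^sup>k + \<beta> b\<close> implies that a multiple of
  \<open>x\<close> is feasible (\<open>\<beta> < 0\<close>), that \<open>x\<close> is a recession direction of the feasible set
  (\<open>\<beta> = 0\<close>), or that \<open>x + \<beta> y\<close> is one for every feasible \<open>y\<close> (\<open>\<beta> > 0\<close>). The objective
  cannot decrease along a recession direction, since the problem is bounded; in the last case the
  infimum over \<open>y\<close> turns this into the claim.
\<close>

lemma value_form_nonneg:
  fixes x :: "real ^ 'n::finite"
  assumes feas: "primal_feasible I a b \<noteq> {}"
    and lower: "\<And>y. y \<in> primal_feasible I a b \<Longrightarrow> V \<le> c \<bullet> y"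
    and greatest: "\<And>W. (\<And>y. y \<in> primal_feasible I a b \<Longrightarrow> W \<le> c \<bullet> y) \<Longrightarrow> W \<le> V"
    and nonneg: "\<And>i. i \<in> I \<Longrightarrow> 0 \<le> data_combination a b (x, \<beta>) i"
  shows "0 \<le> c \<bullet> x + V * \<beta>"
proof -
  define A where "A y i = (\<Sum>k\<in>UNIV. a k i * y $ k)" for y :: "real ^ 'n" and i
  have A_add: "A (y + z) i = A y i + A z i" and A_scale: "A (r *\<^sub>R y) i = r * A y i" for y z r i
    by (simp_all add: A_def sum.distrib sum_distrib_left algebra_simps)
  have feasible_iff: "y \<in> primal_feasible I a b \<longleftrightarrow> (\<forall>i\<in>I. b i \<le> A y i)" for y
    by (simp add: primal_feasible_def A_def)
  have x: "0 \<le> A x i + \<beta> * b i" if "i \<in> I" for i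
    using nonneg[OF that] by (simp add: data_combination_apply A_def mult.commute)
  have recession: "0 \<le> c \<bullet> z" if z: "\<And>i. i \<in> I \<Longrightarrow> 0 \<le> A z i" for z
  proof (rule ccontr)
    assume "\<not> 0 \<le> c \<bullet> z"
    then have neg: "c \<bullet> z < 0" by simp
    obtain y where y: "y \<in> primal_feasible I a b" using feas by blast
    \<comment> \<open>This step length brings the objective down to \<open>V - 1\<close>.\<close>
    define t where "t = (c \<bullet> y - V + 1) / - (c \<bullet> z)"
    have "0 \<le> t"
      unfolding t_def using lower[OF y] neg by (intro divide_nonneg_pos) auto
    then have "y + t *\<^sub>R z \<in> primal_feasible I a b"
      using y z by (force simp: feasible_iff A_add A_scale intro: add_increasing2)
    then have "V \<le> c \<bullet> y + t * (c \<bullet> z)"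
      using lower by (force simp: inner_add_right)
    moreover have "t * (c \<bullet> z) = - (c \<bullet> y - V + 1)"
      using neg by (simp add: t_def)
    ultimately show False by simp
  qed
  consider "\<beta> < 0" | "\<beta> = 0" | "\<beta> > 0" by linarith
  then show ?thesis
  proof cases
    case 1
    have "(1 / - \<beta>) *\<^sub>R x \<in> primal_feasible I a b"
      unfolding feasible_iff A_scale
    proof
      fix i assume "i \<in> I"
      then have "b i * - \<beta> \<le> A x i" using x[of i] by (simp add: mult.commute)
      then show "b i \<le> 1 / - \<beta> * A x i" using 1 by (simp add: field_simps)
    qed
    then have "V \<le> (1 / - \<beta>) * (c \<bullet> x)" using lower by force
    then show ?thesis using 1 by (simp add: field_simps)
  next
    case 2
    then show ?thesis using recession[of x] x by simp
  next
    case 3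
    have "- (c \<bullet> x) / \<beta> \<le> c \<bullet> y" if y: "y \<in> primal_feasible I a b" for y
    proof -
      have "0 \<le> A (x + \<beta> *\<^sub>R y) i" if i: "i \<in> I" for i
      proof -
        have "\<beta> * b i \<le> \<beta> * A y i" using y i 3 by (simp add: feasible_iff)
        then show ?thesis using x[OF i] by (simp add: A_add A_scale)
      qed
      then have "0 \<le> c \<bullet> (x + \<beta> *\<^sub>R y)" by (rule recession)
      then show ?thesis using 3 by (simp add: inner_add_right field_simps)
    qed
    then have "- (c \<bullet> x) / \<beta> \<le> V" by (rule greatest)
    then show ?thesis using 3 by (simp add: field_simps)
  qed
qed

lemma primal_value_attained_by_dual:
  assumes "feasible_and_bounded I a c b"
  obtains \<psi> where "\<psi> \<in> dual_feasible I a c (data_span a b)" "ereal (\<psi> b) = OV I a c b"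
proof -
  obtain V where V: "OV I a c b = ereal V"
    and lower: "\<And>x. x \<in> primal_feasible I a b \<Longrightarrow> V \<le> c \<bullet> x"
    and greatest: "\<And>W. (\<And>x. x \<in> primal_feasible I a b \<Longrightarrow> W \<le> c \<bullet> x) \<Longrightarrow> W \<le> V"
    using finite_primal_value[OF assms] by blast
  define F where "F p = c \<bullet> fst p + V * snd p" for p
  have F: "linear F"
    by (rule linearI) (simp_all add: F_def inner_add_right algebra_simps)
  have pos: "0 \<le> F p" if "\<And>i. i \<in> I \<Longrightarrow> 0 \<le> data_combination a b p i" for p
    using value_form_nonneg[of I a b V c "fst p" "snd p"] that assms lower greatest
    by (simp add: F_def feasible_and_bounded_def)
  have ker: "F p = 0" if "data_combination a b p = 0" for p
  proof -
    have "data_combination a b (- p) = 0"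
      using that by (simp add: linear_neg[OF linear_data_combination])
    then have "0 \<le> F p" "0 \<le> F (- p)"
      using that by (auto intro!: pos)
    then show ?thesis by (simp add: linear_neg[OF F])
  qed
  obtain \<psi> where \<psi>: "\<psi> \<in> algebraic_dual (data_span a b)"
    and val: "\<And>p. \<psi> (data_combination a b p) = F p"
    using functional_on_range_exists[OF linear_data_combination F ker]
    unfolding data_span_eq_range by blast
  have "\<psi> (a k) = c $ k" for k
    using val[of "(axis k 1, 0)"]
    by (simp add: data_combination_generators F_def inner_axis)
  moreover have "0 \<le> \<psi> y" if "y \<in> data_span a b \<inter> nonneg_cone I" for y
    using that pos by (auto simp: data_span_eq_range val nonneg_cone_def)
  ultimately have "\<psi> \<in> dual_feasible I a c (data_span a b)"
    using \<psi> by (simp add: dual_feasible_def positive_dual_def)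
  moreover have "\<psi> b = V"
    using val[of "(0, 1)"] by (simp add: data_combination_generators F_def)
  ultimately show thesis using that V by simp
qed

section \<open>Strong duality\<close>

theorem theorem4p1:
  fixes I :: "'i set"
    and a :: "'n::finite \<Rightarrow> 'i \<Rightarrow> real"
    and b :: "'i \<Rightarrow> real"
    and c :: "real ^ 'n"
  assumes "\<And>k. a k \<in> fun_space I"
    and "b \<in> fun_space I"
    and "feasible_and_bounded I a c b"
  shows "dual_solvable I a c b (data_span a b) \<and>
    strong_duality I a c b (data_span a b) \<and>
    (\<exists>!\<psi>. dual_optimal I a c b (data_span a b) \<psi>)"
proof -
  obtain \<psi> where \<psi>: "\<psi> \<in> dual_feasible I a c (data_span a b)" and val: "ereal (\<psi> b) = OV I a c b"
    using primal_value_attained_by_dual[OF assms(3)] by blast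
  have dual_value: "dual_value I a c b (data_span a b) = OV I a c b"
    unfolding dual_value_def
  proof (rule antisym)
    show "(SUP \<phi>\<in>dual_feasible I a c (data_span a b). ereal (\<phi> b)) \<le> OV I a c b"
      by (rule SUP_least) (rule weak_duality[OF assms(1,2)])
    show "OV I a c b \<le> (SUP \<phi>\<in>dual_feasible I a c (data_span a b). ereal (\<phi> b))"
      unfolding val[symmetric] by (rule SUP_upper[OF \<psi>])
  qed
  have opt: "dual_optimal I a c b (data_span a b) \<psi>"
    using \<psi> val by (simp add: dual_optimal_def dual_value)
  have "\<phi> = \<psi>" if "dual_optimal I a c b (data_span a b) \<phi>" for \<phi>
  proof (rule dual_feasible_determined_by_value[OF _ \<psi>])
    show "\<phi> \<in> dual_feasible I a c (data_span a b)"
      using that by (simp add: dual_optimal_def)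
    have "ereal (\<phi> b) = ereal (\<psi> b)"
      using that by (simp add: dual_optimal_def dual_value val)
    then show "\<phi> b = \<psi> b" by simp
  qed
  then show ?thesis
    using opt \<psi> val unfolding dual_solvable_def strong_duality_def by blast
qed

end
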